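(* Let $p$ be a prime, $q=p^r$, and let $f(x)=ax^{n}+x^{m}$ be a permutation binomial of $\mathbb{F}_q$, where $a\in\mathbb{F}_q^{*}$, $1\le m<n\le q-1$ and $\gcd(m,n)=1$. Let $s$ be a positive divisor of $r$ and let $d=\gcd(n-m,q-1)$. (1) There exists a binomial $g(x)=bx^{n}+x^{m}\in\mathbb{F}_{p^s}[x]$ that is $d$-equivalent to $f(x)$ if and only if the order of $a$ in the group $\mathbb{F}_q^{*}$ divides $\operatorname{lcm}(p^s-1,(q-1)/d)$. (2) If these equivalent conditions hold, then the number of binomials $g(x)=bx^{n}+x^{m}\in\mathbb{F}_{p^s}[x]$ that are $d$-equivalent to $f(x)$ is equal to $\gcd(p^s-1,(q-1)/d)$, and they are all distinct as permutations of $\mathbb{F}_{p^s}$. Moreover, for each such $g$: if $p^s-1\nmid d$, then $g(x)\equiv bx^{n_1}+x^{m_1}\pmod{x^{p^s}-x}$ for some positive integers $m_1\neq n_1$ less than $p^s-1$; and if $p^s-1\mid d$, then $g(x)\equiv (b+1)x^{k}\pmod{x^{p^s}-x}$ for some positive integer $k$ less than $p^s-1$ with $\gcd(p^s-1,k)=1$. (3) Let $t$ be a positive integer (not necessarily dividing $r$). There exists a binomial $g(x)=bx^{n}+x^{m}\in(\mathbb{F}_{p^t}\cap\mathbb{F}_q)[x]$ that is $d$-equivalent to $f(x)$ if and only if the order of $a$ in $\mathbb{F}_q^{*}$ divides $\operatorname{lcm}(p^t-1,(q-1)/d)$.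
   Context: $\mathbb{F}_q$ is the finite field with $q=p^r$ elements; all finite fields of characteristic $p$ are taken inside a fixed algebraic closure of $\mathbb{F}_p$, so that intersections make sense. A permutation binomial of $\mathbb{F}_q$ is a binomial $f(x)=ax^n+x^m$ with $a\ne 0$ whose induced map $\mathbb{F}_q\to\mathbb{F}_q$ is one to one. For fixed integers $1\le m<n\le q-1$ and $d=\gcd(n-m,q-1)$, two binomials $ax^n+x^m$ and $bx^n+x^m$ with coefficients in $\mathbb{F}_q$ and $a,b\neq 0$ are called $d$-equivalent if there exists $\epsilon$ in the set $(\mathbb{F}_q)^d$ of $d$-th powers of elements of $\mathbb{F}_q$ such that $b=\epsilon a$. *)

theory Defs
  imports "HOL-Algebra.Algebraic_Closure_Type"
begin

(* The type 'k carries an algebraic closure of F_p. Its prime field is the image of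
   the integers, i.e. \<int>. *)
definition alg_closure_of_prime_field :: "'k::field itself \<Rightarrow> nat \<Rightarrow> bool" where
  "alg_closure_of_prime_field _ p \<longleftrightarrow>
     CHAR('k) = p \<and> algebraic_closure (ring_of_type_algebra :: 'k ring) \<int>"

(* A field has at most one subfield with q elements, and an algebraic closure of F_p has
   exactly one for every q = p^j with j > 0, so such a K is F_q. *)
definition is_GF :: "nat \<Rightarrow> 'k::field set \<Rightarrow> bool" where
  "is_GF q K \<longleftrightarrow> subfield K ring_of_type_algebra \<and> finite K \<and> card K = q"

definition mult_order :: "'k::field set \<Rightarrow> 'k \<Rightarrow> nat" where
  "mult_order K x = group.ord (mult_of (ring_of_type_algebra\<lparr>carrier := K\<rparr>)) x"

definition polys_over :: "'k::field set \<Rightarrow> 'k poly set" where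
  "polys_over K = {f. set (coeffs f) \<subseteq> K}"

(* congruence modulo h in the ring K[x]: the cofactor has its coefficients in K *)
definition cong_over :: "'k::field set \<Rightarrow> 'k poly \<Rightarrow> 'k poly \<Rightarrow> 'k poly \<Rightarrow> bool" where
  "cong_over K f g h \<longleftrightarrow>
     f \<in> polys_over K \<and> g \<in> polys_over K \<and> (\<exists>u \<in> polys_over K. f - g = h * u)"

definition binom_poly :: "'k::field \<Rightarrow> nat \<Rightarrow> nat \<Rightarrow> 'k poly" where
  "binom_poly a n m = Polynomial.monom a n + Polynomial.monom 1 m"

(* Here d = gcd (n - m) (card F - 1); the image is the set of d-th powers of elements of F. *)
definition d_equivalent :: "'k::field set \<Rightarrow> nat \<Rightarrow> nat \<Rightarrow> 'k poly \<Rightarrow> 'k poly \<Rightarrow> bool" where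
  "d_equivalent F n m f g \<longleftrightarrow>
     (\<exists>a \<in> F - {0}. \<exists>b \<in> F - {0}. f = binom_poly a n m \<and> g = binom_poly b n m \<and>
        (\<exists>\<epsilon> \<in> (\<lambda>c. c ^ gcd (n - m) (card F - 1)) ` F. b = \<epsilon> * a))"

definition equiv_binomials ::
    "'k::field set \<Rightarrow> nat \<Rightarrow> nat \<Rightarrow> 'k poly \<Rightarrow> 'k set \<Rightarrow> 'k poly set" where
  "equiv_binomials F n m f K = {g \<in> polys_over K. d_equivalent F n m f g}"

end

theory Submission
  imports Defs
begin

text \<open>
  Let \<open>e = (q - 1) div d\<close>. The nonzero \<open>d\<close>-th powers of \<open>F\<^sub>q\<close> are the \<open>e\<close>-th roots of unity, and the
  nonzero elements of a field with \<open>p ^ t\<close> elements are the \<open>(p ^ t - 1)\<close>-th roots of unity. Hence the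
  binomials in question are given by the solutions \<open>b\<close> of \<open>b ^ (p ^ t - 1) = 1\<close>, \<open>b ^ e = a ^ e\<close>. By
  Bezout such a \<open>b\<close> exists if and only if \<open>a ^ lcm (p ^ t - 1) e = 1\<close>, and then the solutions form a
  coset of the group of \<open>gcd (p ^ t - 1) e\<close>-th roots of unity. If \<open>b = c ^ (n - m) * a\<close>, then
  \<open>f (c * x) = c ^ m * g x\<close>, so every such \<open>g\<close> is injective on \<open>F\<^sub>q\<close>, hence permutes the subfield of
  order \<open>p ^ s\<close>. An exponent of \<open>g\<close> divisible by \<open>p ^ s - 1\<close> would make one term constant on the nonzero
  elements of the subfield; the other term would then be injective there, hence surjective, and \<open>g\<close>
  would have a nonzero root.
\<close>

section \<open>Finite subfields\<close>

text \<open>Transfers the subfield axioms from the ring record to the type class operations. Only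
  negation takes an argument, by uniqueness of the additive inverse.\<close>

lemma is_GF_D:
  fixes K :: "'k::field set"
  assumes "is_GF q K"
  shows is_GF_finite: "finite K" and is_GF_card: "card K = q"
    and is_GF_0: "0 \<in> K" and is_GF_1: "1 \<in> K"
    and is_GF_uminus: "x \<in> K \<Longrightarrow> - x \<in> K"
    and is_GF_add: "x \<in> K \<Longrightarrow> y \<in> K \<Longrightarrow> x + y \<in> K"
    and is_GF_mult: "x \<in> K \<Longrightarrow> y \<in> K \<Longrightarrow> x * y \<in> K"
proof -
  let ?R = "ring_of_type_algebra :: 'k ring"
  interpret R: field ?R by (rule field_from_type_algebra)
  have sf: "subfield K ?R" and fin: "finite K" "card K = q"
    using assms by (auto simp: is_GF_def)
  show "finite K" "card K = q" by fact+
  note sr = subringE[OF subfieldE(1)[OF sf]]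
  show "0 \<in> K" "1 \<in> K"
    using sr(2,3) by (simp_all add: ring_of_type_algebra_def)
  show "x + y \<in> K" if "x \<in> K" "y \<in> K"
    using sr(7)[OF that] by (simp add: ring_of_type_algebra_def)
  show "x * y \<in> K" if "x \<in> K" "y \<in> K"
    using sr(6)[OF that] by (simp add: ring_of_type_algebra_def)
  have "\<ominus>\<^bsub>?R\<^esub> x = - x"
  proof (rule R.minus_equality)
    show "(- x) \<oplus>\<^bsub>?R\<^esub> x = \<zero>\<^bsub>?R\<^esub>" "x \<in> carrier ?R" "- x \<in> carrier ?R"
      by (simp_all add: ring_of_type_algebra_def)
  qed
  then show "- x \<in> K" if "x \<in> K"
    using sr(5)[OF that] by simp
qed

lemma is_GF_power:
  assumes "is_GF q K" "x \<in> K"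
  shows "x ^ i \<in> K"
  by (induction i) (auto intro: is_GF_1[OF assms(1)] is_GF_mult[OF assms(1)] assms(2))

lemma is_GF_ge_2:
  fixes K :: "'k::field set"
  assumes "is_GF q K"
  shows "2 \<le> q"
proof -
  have "card {0, 1 :: 'k} \<le> card K"
    using is_GF_0[OF assms] is_GF_1[OF assms] is_GF_finite[OF assms] by (intro card_mono) auto
  then show ?thesis
    using is_GF_card[OF assms] by simp
qed

section \<open>The multiplicative group and roots of unity\<close>

lemma is_GF_mult_group:
  fixes K :: "'k::field set"
  assumes "is_GF q K"
  defines "G \<equiv> mult_of (ring_of_type_algebra\<lparr>carrier := K\<rparr>)"
  shows "group G" and "carrier G = K - {0}" and "\<one>\<^bsub>G\<^esub> = 1"
    and "x [^]\<^bsub>G\<^esub> (i::nat) = x ^ i"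
proof -
  interpret R: field "ring_of_type_algebra :: 'k ring" by (rule field_from_type_algebra)
  have "subfield K ring_of_type_algebra"
    using assms by (auto simp: is_GF_def)
  \<comment> \<open>Two constants named \<open>mult_of\<close> occur, with the same unfolding; the
    group property is carried over from one to the other.\<close>
  then have "group (Multiplicative_Group.mult_of (ring_of_type_algebra\<lparr>carrier := K\<rparr>))"
    by (intro field.field_mult_group R.subfield_iff(2))
  then show grp: "group G"
    by (simp add: G_def mult_of_def Multiplicative_Group.mult_of_def)
  show "carrier G = K - {0}" and one: "\<one>\<^bsub>G\<^esub> = 1"
    by (simp_all add: G_def ring_of_type_algebra_def)
  have mult: "x \<otimes>\<^bsub>G\<^esub> y = x * y" for x y
    by (simp add: G_def ring_of_type_algebra_def)
  interpret G: group G by (rule grp)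
  show "x [^]\<^bsub>G\<^esub> (i::nat) = x ^ i"
    by (induction i) (simp_all add: one mult)
qed

lemma mult_order_dvd_iff:
  assumes "is_GF q K" "x \<in> K - {0}"
  shows "mult_order K x dvd i \<longleftrightarrow> x ^ i = 1"
proof -
  note G = is_GF_mult_group[OF assms(1)]
  show ?thesis
    unfolding mult_order_def
    using group.pow_eq_id[OF G(1), unfolded G, of x i] assms(2) by simp
qed

lemma is_GF_power_card:
  assumes "is_GF q K" "x \<in> K - {0}"
  shows "x ^ (q - 1) = 1"
proof -
  note G = is_GF_mult_group[OF assms(1)]
  have "Coset.order (mult_of (ring_of_type_algebra\<lparr>carrier := K\<rparr>)) = q - 1"
    unfolding Coset.order_def G(2)
    using is_GF_0[OF assms(1)] is_GF_finite[OF assms(1)] is_GF_card[OF assms(1)] by simp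
  then show ?thesis
    using group.pow_order_eq_1[OF G(1), unfolded G, of x] assms(2) by simp
qed

lemma card_power_eq_le:
  fixes c :: "'k::field"
  assumes "0 < k"
  shows "finite {x. x ^ k = c}" and "card {x. x ^ k = c} \<le> k"
proof -
  let ?p = "Polynomial.monom 1 k - [:c:]"
  have "Polynomial.coeff ?p k = 1"
    using assms by (simp add: coeff_pCons split: nat.split)
  then have nz: "?p \<noteq> 0" by (metis coeff_0 zero_neq_one)
  have eq: "{x. x ^ k = c} = {x. poly ?p x = 0}"
    by (auto simp: poly_monom)
  show "finite {x. x ^ k = c}"
    unfolding eq by (rule poly_roots_finite[OF nz])
  have "card {x. x ^ k = c} \<le> Polynomial.degree ?p"
    unfolding eq by (rule card_poly_roots_bound[OF nz])
  also have "\<dots> \<le> k"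
    by (intro degree_diff_le degree_monom_le) auto
  finally show "card {x. x ^ k = c} \<le> k" .
qed

text \<open>Lagrange's theorem gives one inclusion, and the bound on the number of roots makes it an
  equality. Membership in \<open>K\<close> thus becomes a power equation in the ambient
  field.\<close>

lemma is_GF_nonzero_eq:
  assumes "is_GF q K"
  shows "K - {0} = {x. x ^ (q - 1) = 1}"
proof (rule card_seteq)
  have q: "0 < q - 1"
    using is_GF_ge_2[OF assms] by simp
  show "finite {x::'a. x ^ (q - 1) = 1}"
    by (rule card_power_eq_le(1)[OF q])
  show "K - {0} \<subseteq> {x. x ^ (q - 1) = 1}"
    using is_GF_power_card[OF assms] by auto
  have "card {x::'a. x ^ (q - 1) = 1} \<le> q - 1"
    by (rule card_power_eq_le(2)[OF q])
  then show "card {x::'a. x ^ (q - 1) = 1} \<le> card (K - {0})"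
    using is_GF_0[OF assms] is_GF_finite[OF assms] is_GF_card[OF assms] by simp
qed

text \<open>
  The fibres of \<open>x \<mapsto> x ^ d\<close> on the \<open>e * d\<close> nonzero elements have at most \<open>d\<close> elements, and the
  image lies in the set of \<open>e\<close>-th roots of unity; so the two bounds are attained.
\<close>

lemma is_GF_power_image:
  fixes K :: "'k::field set"
  assumes "is_GF q K" "q - 1 = e * d"
  shows "(\<lambda>x. x ^ d) ` (K - {0}) = {x. x ^ e = 1}" and "card {x :: 'k. x ^ e = 1} = e"
proof -
  have pos: "0 < e" "0 < d"
    using is_GF_ge_2[OF assms(1)] assms(2) by (auto intro!: Nat.gr0I)
  let ?I = "(\<lambda>x. x ^ d) ` (K - {0})"
  have fin: "finite (K - {0})"
    using is_GF_finite[OF assms(1)] by simp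
  have sub: "?I \<subseteq> {x. x ^ e = 1}"
    using is_GF_power_card[OF assms(1), unfolded assms(2)]
    by (auto simp: mult.commute simp flip: power_mult)
  have "e * d = card (K - {0})"
    using is_GF_0[OF assms(1)] is_GF_finite[OF assms(1)] is_GF_card[OF assms(1)] assms(2) by simp
  also have "K - {0} = (\<Union>y\<in>?I. {x \<in> K - {0}. x ^ d = y})"
    by auto
  also have "card \<dots> \<le> (\<Sum>y\<in>?I. card {x \<in> K - {0}. x ^ d = y})"
    using fin by (intro card_UN_le) auto
  also have "\<dots> \<le> (\<Sum>y\<in>?I. d)"
  proof (intro sum_mono)
    fix y
    have "card {x \<in> K - {0}. x ^ d = y} \<le> card {x. x ^ d = y}"
      using card_power_eq_le(1)[OF pos(2), of y] by (intro card_mono) auto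
    also have "\<dots> \<le> d"
      by (rule card_power_eq_le(2)[OF pos(2)])
    finally show "card {x \<in> K - {0}. x ^ d = y} \<le> d" .
  qed
  also have "\<dots> = card ?I * d"
    by simp
  finally have le: "e \<le> card ?I"
    using pos by simp
  note roots = card_power_eq_le[OF pos(1), where c = "1 :: 'k"]
  show eq: "?I = {x. x ^ e = 1}"
    by (rule card_seteq[OF roots(1) sub]) (use le roots(2) in simp)
  then show "card {x :: 'k. x ^ e = 1} = e"
    using le roots(2) by (simp add: eq)
qed

lemma pow_minus_1_dvd:
  assumes "s dvd r" "0 < (p::nat)"
  shows "p ^ s - 1 dvd p ^ r - 1"
proof -
  obtain k where k: "r = s * k" using assms(1) by blast
  \<comment> \<open>Over the integers \<open>y - 1\<close> divides \<open>y ^ k - 1\<close>;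
    truncated subtraction agrees with this because the powers of \<open>p\<close> are
    positive.\<close>
  have "int (p ^ s) - 1 dvd int (p ^ s) ^ k - 1"
    by (simp add: power_diff_1_eq)
  then have "int (p ^ s - 1) dvd int (p ^ r - 1)"
    using assms(2) by (simp add: k power_mult)
  then show ?thesis by (simp only: int_dvd_int_iff)
qed

text \<open>A \<open>(Q - 1)\<close>-th root of unity is also a \<open>(q - 1)\<close>-th one, and
  all of those lie in \<open>K\<close>.\<close>

lemma is_GF_mono:
  assumes "is_GF Q F" "is_GF q K" "Q - 1 dvd q - 1"
  shows "F \<subseteq> K"
proof
  fix x assume x: "x \<in> F"
  show "x \<in> K"
  proof (cases "x = 0")
    case True
    then show ?thesis using is_GF_0[OF assms(2)] by simp
  next
    case False
    then have "x ^ (Q - 1) = 1"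
      using x is_GF_power_card[OF assms(1)] by simp
    then have "x ^ (q - 1) = 1"
      using assms(3) by (auto simp: power_mult dvd_def)
    then show ?thesis
      using is_GF_nonzero_eq[OF assms(2)] by auto
  qed
qed


section \<open>A pair of power equations\<close>

lemma power_gcd_eq_1_iff:
  fixes z :: "'k::field"
  assumes "0 < k"
  shows "z ^ gcd k l = 1 \<longleftrightarrow> z ^ k = 1 \<and> z ^ l = 1"
proof
  assume "z ^ gcd k l = 1"
  moreover obtain u v where "k = gcd k l * u" "l = gcd k l * v"
    by (meson gcd_dvd1 gcd_dvd2 dvdE)
  ultimately show "z ^ k = 1 \<and> z ^ l = 1"
    by (metis power_mult power_one)
next
  assume z: "z ^ k = 1 \<and> z ^ l = 1"
  \<comment> \<open>Bezout with natural coefficients: all exponents are nonnegative, so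
    \<open>z\<close> is never inverted. This orientation requires \<open>k\<close> to be
    nonzero.\<close>
  obtain x y where "k * x = l * y + gcd k l"
    using bezout_nat[of k l] assms by auto
  then have "z ^ (k * x) = z ^ (l * y) * z ^ gcd k l"
    by (simp add: power_add)
  then show "z ^ gcd k l = 1"
    using z by (simp add: power_mult)
qed

lemma power_pair_solvable_iff:
  fixes a :: "'k::field"
  assumes "0 < k" "0 < l"
  shows "(\<exists>b. b ^ k = 1 \<and> b ^ l = a ^ l) \<longleftrightarrow> a ^ lcm k l = 1"
proof
  assume "\<exists>b. b ^ k = 1 \<and> b ^ l = a ^ l"
  then obtain b where b: "b ^ k = 1" "b ^ l = a ^ l" by blast
  obtain u v where uv: "lcm k l = k * u" "lcm k l = l * v"
    by (meson dvd_lcm1 dvd_lcm2 dvdE)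
  have "a ^ lcm k l = b ^ (l * v)"
    by (simp add: uv(2) power_mult b(2))
  also have "\<dots> = b ^ (k * u)"
    by (simp flip: uv)
  finally show "a ^ lcm k l = 1"
    by (simp add: power_mult b(1))
next
  assume a: "a ^ lcm k l = 1"
  define g where "g = gcd k l"
  have "gcd k l \<noteq> 0" using assms by simp
  from gcd_coprime_exists[OF this] obtain k' l' where
    kl: "k = k' * g" "l = l' * g" "coprime k' l'"
    unfolding g_def by blast
  have pos: "0 < g" "0 < k'" "0 < l'"
    using assms kl by (auto intro!: Nat.gr0I)
  have "g * lcm k l = k * l"
    unfolding g_def by (rule prod_gcd_lcm_nat[symmetric])
  also have "\<dots> = g * (g * k' * l')"
    by (simp add: kl(1,2) ac_simps)
  finally have L: "lcm k l = g * k' * l'" using pos by simp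
  \<comment> \<open>Here \<open>x\<close> inverts \<open>l'\<close> modulo \<open>k'\<close>. The
    witness is \<open>a ^ (l' * x)\<close>: its exponent times \<open>k\<close> is a multiple of the
    lcm, and its exponent times \<open>l\<close> is \<open>l\<close> plus a multiple of the
    lcm.\<close>
  obtain x y where xy: "l' * x = k' * y + 1"
    using bezout_nat[of l' k'] pos(3) kl(3) by (auto simp: coprime_commute)
  have "l' * x * k = lcm k l * x"
    unfolding L by (simp add: kl(1) ac_simps)
  then have "(a ^ (l' * x)) ^ k = (a ^ lcm k l) ^ x"
    by (simp only: power_mult[symmetric])
  moreover have "l' * x * l = lcm k l * y + l"
    unfolding L xy by (simp add: kl(2) algebra_simps)
  then have "(a ^ (l' * x)) ^ l = (a ^ lcm k l) ^ y * a ^ l"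
    by (simp only: power_mult[symmetric] power_add[symmetric])
  ultimately show "\<exists>b. b ^ k = 1 \<and> b ^ l = a ^ l"
    using a by (intro exI[of _ "a ^ (l' * x)"]) simp
qed

text \<open>Multiplication by one fixed solution carries the \<open>gcd k l\<close>-th roots of
  unity bijectively onto the solution set, with division as the inverse map.\<close>

lemma card_power_pair:
  fixes c :: "'k::field"
  assumes "0 < k" "c \<noteq> 0" "\<exists>b. b ^ k = 1 \<and> b ^ l = c"
  shows "card {b. b ^ k = 1 \<and> b ^ l = c} = card {z :: 'k. z ^ gcd k l = 1}"
proof -
  obtain b where b: "b ^ k = 1" "b ^ l = c" using assms(3) by blast
  have nz: "b \<noteq> 0" using b(1) assms(1) by (auto simp: power_0_left)
  have "bij_betw (\<lambda>z. z * b) {z. z ^ gcd k l = 1} {b. b ^ k = 1 \<and> b ^ l = c}"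
    by (rule bij_betwI[where g = "\<lambda>x. x / b"])
      (use nz b assms(1,2) in \<open>auto simp: power_gcd_eq_1_iff power_mult_distrib power_divide\<close>)
  then show ?thesis
    by (simp add: bij_betw_same_card)
qed


section \<open>Equivalent binomials\<close>

lemma poly_binom_poly [simp]: "poly (binom_poly b n m) x = b * x ^ n + x ^ m"
  by (simp add: binom_poly_def poly_monom)

lemma binom_poly_eq_iff:
  assumes "m < n"
  shows "binom_poly a n m = binom_poly b n m \<longleftrightarrow> a = b"
proof
  assume "binom_poly a n m = binom_poly b n m"
  then have "Polynomial.coeff (binom_poly a n m) n = Polynomial.coeff (binom_poly b n m) n"
    by simp
  then show "a = b"
    using assms by (simp add: binom_poly_def)
qed simp

text \<open>\<open>coeffs\<close> stops at the leading coefficient; since \<open>0 \<in> K\<close>,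
  the condition can be put on all coefficients, which makes closure under addition
  immediate.\<close>

lemma polys_over_iff:
  assumes "0 \<in> K"
  shows "f \<in> polys_over K \<longleftrightarrow> (\<forall>i. Polynomial.coeff f i \<in> K)"
proof -
  have "f \<in> polys_over K \<longleftrightarrow> range (Polynomial.coeff f) \<subseteq> K"
    using assms by (simp add: polys_over_def range_coeff)
  then show ?thesis
    by blast
qed

lemma binom_poly_in_polys_over_iff:
  assumes "0 \<in> K" "1 \<in> K" "m < n"
  shows "binom_poly b n m \<in> polys_over K \<longleftrightarrow> b \<in> K"
proof
  assume "binom_poly b n m \<in> polys_over K"
  then have "Polynomial.coeff (binom_poly b n m) n \<in> K"
    using polys_over_iff[OF assms(1)] by blast
  then show "b \<in> K"
    using assms(3) by (simp add: binom_poly_def)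
next
  assume "b \<in> K"
  then show "binom_poly b n m \<in> polys_over K"
    using assms by (auto simp: polys_over_iff binom_poly_def)
qed

text \<open>Membership of a nonzero \<open>b\<close> in \<open>F\<close> means
  \<open>b ^ (Q - 1) = 1\<close>, and \<open>b / a\<close> is a nonzero \<open>d\<close>-th power
  exactly if \<open>(b / a) ^ e = 1\<close>. The lemma covers an \<open>F\<close> that is not inside
  \<open>K\<close>, as the claim for arbitrary \<open>t\<close> requires.\<close>

lemma equiv_binomials_eq:
  assumes "is_GF q K" "is_GF Q F" "m < n" "a \<in> K - {0}"
  defines "e \<equiv> (q - 1) div gcd (n - m) (q - 1)"
  shows "equiv_binomials K n m (binom_poly a n m) (F \<inter> K) =
    (\<lambda>b. binom_poly b n m) ` {b. b ^ (Q - 1) = 1 \<and> b ^ e = a ^ e}"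
proof -
  let ?d = "gcd (n - m) (q - 1)"
  have qe: "q - 1 = e * ?d"
    by (simp add: e_def)
  have nonzero: "b \<noteq> 0" if "b ^ (Q - 1) = 1" for b :: 'a
    using that is_GF_ge_2[OF assms(2)] by (auto simp: power_0_left)
  have "b \<in> F \<inter> K \<and> b \<in> K - {0} \<and> (\<exists>\<epsilon> \<in> (\<lambda>c. c ^ ?d) ` K. b = \<epsilon> * a) \<longleftrightarrow>
      b ^ (Q - 1) = 1 \<and> b ^ e = a ^ e" (is "?L \<longleftrightarrow> ?R") for b
  proof
    assume ?L
    then obtain c where c: "c \<in> K" "b = c ^ ?d * a" "b \<in> F" "b \<noteq> 0" by auto
    \<comment> \<open>\<open>?d\<close> is positive because \<open>m < n\<close>, so
      \<open>c = 0\<close> would force \<open>b = 0\<close>.\<close>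
    then have "c \<noteq> 0"
      using assms(3) by (auto simp: power_0_left)
    then have "(c ^ ?d) ^ e = 1"
      using is_GF_power_card[OF assms(1), of c] c(1)
      by (simp only: power_mult[symmetric] qe[symmetric] mult.commute) simp
    then show ?R
      using c is_GF_power_card[OF assms(2), of b] by (simp add: power_mult_distrib)
  next
    assume R: ?R
    then have nz: "b \<noteq> 0" using nonzero by blast
    have F: "b \<in> F"
      using R is_GF_nonzero_eq[OF assms(2)] by auto
    have "(b / a) ^ e = 1"
      using R assms(4) by (simp add: power_divide)
    then have "b / a \<in> (\<lambda>c. c ^ ?d) ` (K - {0})"
      using is_GF_power_image(1)[OF assms(1) qe] by blast
    then obtain c where c: "c \<in> K" "b / a = c ^ ?d" by auto
    then have ba: "b = c ^ ?d * a"
      using assms(4) by (simp add: field_simps)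
    have "b \<in> K"
      unfolding ba using assms(4) c(1) is_GF_power[OF assms(1)] is_GF_mult[OF assms(1)] by auto
    then show ?L
      using F nz c(1) ba by auto
  qed
  moreover have "equiv_binomials K n m (binom_poly a n m) (F \<inter> K) = (\<lambda>b. binom_poly b n m) `
      {b. b \<in> F \<inter> K \<and> b \<in> K - {0} \<and> (\<exists>\<epsilon> \<in> (\<lambda>c. c ^ ?d) ` K. b = \<epsilon> * a)}"
  proof -
    have "0 \<in> F \<inter> K" "1 \<in> F \<inter> K"
      using is_GF_0 is_GF_1 assms(1,2) by blast+
    note po = binom_poly_in_polys_over_iff[OF this assms(3)]
    show ?thesis
      unfolding equiv_binomials_def d_equivalent_def is_GF_card[OF assms(1)]
      using assms(4) by (auto simp: binom_poly_eq_iff[OF assms(3)] po simp del: Int_iff)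
  qed
  ultimately show ?thesis
    by simp
qed

lemma ex_equiv_binomials_iff:
  assumes "is_GF q K" "is_GF Q F" "m < n" "a \<in> K - {0}"
  shows "(\<exists>g. g \<in> equiv_binomials K n m (binom_poly a n m) (F \<inter> K)) \<longleftrightarrow>
    mult_order K a dvd lcm (Q - 1) ((q - 1) div gcd (n - m) (q - 1))"
proof -
  have "0 < Q - 1" "0 < (q - 1) div gcd (n - m) (q - 1)"
    using is_GF_ge_2[OF assms(1)] is_GF_ge_2[OF assms(2)]
    by (auto simp: div_greater_zero_iff intro!: gcd_le2_nat)
  note solvable = power_pair_solvable_iff[OF this, of a]
  show ?thesis
    unfolding equiv_binomials_eq[OF assms] mult_order_dvd_iff[OF assms(1,4)] solvable[symmetric]
    by blast
qed

lemma card_equiv_binomials: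
  assumes "is_GF q K" "is_GF Q F" "m < n" "a \<in> K - {0}"
    and "equiv_binomials K n m (binom_poly a n m) (F \<inter> K) \<noteq> {}"
  shows "card (equiv_binomials K n m (binom_poly a n m) (F \<inter> K)) =
    gcd (Q - 1) ((q - 1) div gcd (n - m) (q - 1))"
proof -
  define e where "e = (q - 1) div gcd (n - m) (q - 1)"
  note eq = equiv_binomials_eq[OF assms(1-4), folded e_def]
  have "e dvd q - 1"
    by (rule dvdI[of _ _ "gcd (n - m) (q - 1)"]) (simp add: e_def)
  \<comment> \<open>Because the gcd divides \<open>q - 1\<close>, the number of roots of unity for
    this exponent is the gcd itself; \<open>j\<close> is the complementary factor.\<close>
  then have "gcd (Q - 1) e dvd q - 1"
    by (rule dvd_trans[OF gcd_dvd2])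
  then obtain j where j: "q - 1 = gcd (Q - 1) e * j" ..
  have "inj_on (\<lambda>b. binom_poly b n m) {b. b ^ (Q - 1) = 1 \<and> b ^ e = a ^ e}"
    by (simp add: inj_on_def binom_poly_eq_iff[OF assms(3)])
  then have "card (equiv_binomials K n m (binom_poly a n m) (F \<inter> K)) =
      card {b. b ^ (Q - 1) = 1 \<and> b ^ e = a ^ e}"
    unfolding eq by (rule card_image)
  also have "\<dots> = card {z :: 'a. z ^ gcd (Q - 1) e = 1}"
    using assms(4,5) is_GF_ge_2[OF assms(2)] unfolding eq by (intro card_power_pair) auto
  also have "\<dots> = gcd (Q - 1) e"
    by (rule is_GF_power_image(2)[OF assms(1) j])
  finally show ?thesis
    by (simp add: e_def)
qed

text \<open>Substituting \<open>y * x\<close> for \<open>x\<close> turns \<open>f\<close> into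
  \<open>y ^ m\<close> times \<open>g\<close> for a suitable \<open>y\<close>, so \<open>g\<close>
  inherits injectivity. Injectivity is the form that restricts to subfields.\<close>

lemma equiv_binomial_permutes:
  assumes "is_GF q K" "m < n" "d_equivalent K n m f g" "bij_betw (poly f) K K"
  shows "inj_on (poly g) K"
proof -
  let ?d = "gcd (n - m) (q - 1)"
  obtain a b c where abc: "a \<in> K - {0}" "b \<in> K - {0}" "f = binom_poly a n m"
      "g = binom_poly b n m" "c \<in> K" "b = c ^ ?d * a"
    using assms(3) unfolding d_equivalent_def is_GF_card[OF assms(1)] by blast
  then have "c \<noteq> 0"
    using assms(2) by (auto simp: power_0_left)
  then have c: "c ^ (q - 1) = 1"
    using is_GF_power_card[OF assms(1)] abc(5) by simp
  \<comment> \<open>Bezout modulo \<open>q - 1\<close> rewrites the \<open>?d\<close>-th power of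
    \<open>c\<close> as the \<open>(n - m)\<close>-th power of \<open>c ^ u\<close>, which is what
    the substitution needs.\<close>
  obtain u v where "(n - m) * u = (q - 1) * v + ?d"
    using bezout_nat[of "n - m" "q - 1"] assms(2) by auto
  then have "c ^ ((n - m) * u) = c ^ ((q - 1) * v) * c ^ ?d"
    by (simp only: power_add)
  then have "c ^ ((n - m) * u) = c ^ ?d"
    by (simp only: power_mult c power_one mult_1)
  then have u: "(c ^ u) ^ (n - m) = c ^ ?d"
    by (simp only: power_mult[symmetric] mult.commute)
  define y where "y = c ^ u"
  have y: "y \<noteq> 0" "y \<in> K" "b = y ^ (n - m) * a"
    using \<open>c \<noteq> 0\<close> is_GF_power[OF assms(1) abc(5)] abc(6) u by (simp_all add: y_def)
  have "y ^ n = y ^ (n - m) * y ^ m"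
    using assms(2) by (simp flip: power_add)
  then have shift: "poly f (y * x) = y ^ m * poly g x" for x
    by (simp add: abc(3,4) y(3) algebra_simps)
  show ?thesis
  proof (rule inj_onI)
    fix x x' assume x: "x \<in> K" "x' \<in> K" "poly g x = poly g x'"
    then have "poly f (y * x) = poly f (y * x')"
      by (simp add: shift)
    then have "y * x = y * x'"
      by (rule inj_onD[OF bij_betw_imp_inj_on[OF assms(4)]])
        (intro is_GF_mult[OF assms(1) y(2)] x(1,2))+
    then show "x = x'"
      using y(1) by simp
  qed
qed

lemma poly_in_is_GF:
  assumes "is_GF q K" "f \<in> polys_over K" "x \<in> K"
  shows "poly f x \<in> K"
proof -
  have "set (coeffs f) \<subseteq> K"
    using assms(2) by (simp add: polys_over_def)
  moreover have "foldr (\<lambda>c y. c + x * y) cs 0 \<in> K" if "set cs \<subseteq> K" for cs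
    using that
    by (induction cs) (auto intro: is_GF_0[OF assms(1)] is_GF_add[OF assms(1)]
        is_GF_mult[OF assms(1)] assms(3))
  moreover have "poly f x = foldr (\<lambda>c y. c + x * y) (coeffs f) 0"
    by (induction f) (auto simp: cCons_def)
  ultimately show ?thesis
    by simp
qed


section \<open>Reduction modulo \<open>x^Q - x\<close>\<close>

lemma polys_over_closed:
  fixes K :: "'k::field set"
  assumes "is_GF q K"
  shows polys_over_0: "0 \<in> polys_over K"
    and polys_over_monom: "c \<in> K \<Longrightarrow> Polynomial.monom c i \<in> polys_over K"
    and polys_over_add: "f \<in> polys_over K \<Longrightarrow> g \<in> polys_over K \<Longrightarrow> f + g \<in> polys_over K"
  using is_GF_0[OF assms] is_GF_add[OF assms] by (auto simp: polys_over_iff)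

lemma cong_over_refl:
  assumes "is_GF q K" "f \<in> polys_over K"
  shows "cong_over K f f h"
  unfolding cong_over_def using assms polys_over_0 by force

lemma cong_over_add:
  assumes "is_GF q K" "cong_over K f g h" "cong_over K f' g' h"
  shows "cong_over K (f + f') (g + g') h"
proof -
  obtain u u' where u: "u \<in> polys_over K" "f - g = h * u" "u' \<in> polys_over K" "f' - g' = h * u'"
    using assms by (auto simp: cong_over_def)
  then have "f + f' - (g + g') = h * (u + u')"
    by (simp add: distrib_left flip: u(2,4))
  then show ?thesis
    using assms u polys_over_add[OF assms(1)] unfolding cong_over_def by blast
qed

lemma cong_over_trans:
  assumes "is_GF q K" "cong_over K f g h" "cong_over K g k h"
  shows "cong_over K f k h"
proof -
  obtain u u' where u: "u \<in> polys_over K" "f - g = h * u" "u' \<in> polys_over K" "g - k = h * u'"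
    using assms by (auto simp: cong_over_def)
  then have "f - k = h * (u + u')"
    by (simp add: distrib_left flip: u(2,4))
  then show ?thesis
    using assms u polys_over_add[OF assms(1)] unfolding cong_over_def by blast
qed

text \<open>Subtracting a monomial multiple of \<open>x ^ Q - x\<close> lowers an exponent by
  \<open>Q - 1\<close> as long as the result stays positive; a positive residue ensures this down to
  the last step.\<close>

lemma monom_cong_over_mod:
  fixes K :: "'k::field set"
  assumes "is_GF q K" "c \<in> K" "0 < i mod (Q - 1)" "2 \<le> Q"
  shows "cong_over K (Polynomial.monom c i) (Polynomial.monom c (i mod (Q - 1)))
    (Polynomial.monom 1 Q - Polynomial.monom 1 1)"
proof -
  let ?h = "Polynomial.monom 1 Q - Polynomial.monom 1 1 :: 'k poly"
  define l where "l = i mod (Q - 1)"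
  have "cong_over K (Polynomial.monom c (l + (Q - 1) * j)) (Polynomial.monom c l) ?h" for j
  proof (induction j)
    case 0
    then show ?case
      by (simp add: cong_over_refl[OF assms(1)] polys_over_monom[OF assms(1,2)])
  next
    case (Suc j)
    let ?k = "l + (Q - 1) * j"
    \<comment> \<open>As \<open>?k\<close> is positive, \<open>?k - 1\<close> is a true predecessor,
      and the cofactor is the monomial of that exponent.\<close>
    have "l + (Q - 1) * Suc j = Q + (?k - 1)" "?k = 1 + (?k - 1)"
      using assms(3,4) by (simp_all add: l_def)
    then have "Polynomial.monom c (l + (Q - 1) * Suc j) - Polynomial.monom c ?k =
        ?h * Polynomial.monom c (?k - 1)"
      by (simp only: left_diff_distrib mult_monom) simp
    then have "cong_over K (Polynomial.monom c (l + (Q - 1) * Suc j)) (Polynomial.monom c ?k) ?h"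
      unfolding cong_over_def using polys_over_monom[OF assms(1,2)] by blast
    then show ?case
      using Suc cong_over_trans[OF assms(1)] by blast
  qed
  from this[of "i div (Q - 1)"] show ?thesis
    by (simp add: l_def)
qed

section \<open>Exponents of a permutation binomial\<close>

lemma is_GF_power_mod:
  assumes "is_GF q K" "x \<in> K - {0}"
  shows "x ^ i = x ^ (i mod (q - 1))"
proof -
  have "x ^ i = x ^ ((q - 1) * (i div (q - 1)) + i mod (q - 1))"
    by simp
  also have "\<dots> = (x ^ (q - 1)) ^ (i div (q - 1)) * x ^ (i mod (q - 1))"
    by (simp only: power_add power_mult)
  finally show ?thesis
    by (simp only: is_GF_power_card[OF assms] power_one mult_1)
qed

text \<open>An injective self-map of the finite set \<open>K - {0}\<close> is surjective, so
  \<open>c * x ^ i\<close> takes the value \<open>- y\<close>.\<close>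

lemma power_inj_imp_root:
  assumes "is_GF q K" "c \<in> K - {0}" "y \<in> K - {0}"
    and "inj_on (\<lambda>x. c * x ^ i + y) (K - {0})"
  shows "\<exists>x \<in> K - {0}. c * x ^ i + y = 0"
proof -
  have "inj_on (\<lambda>x. c * x ^ i) (K - {0})"
  proof (rule inj_onI)
    fix u v assume uv: "u \<in> K - {0}" "v \<in> K - {0}" "c * u ^ i = c * v ^ i"
    show "u = v"
      by (rule inj_onD[OF assms(4) _ uv(1,2)]) (simp only: uv(3))
  qed
  moreover have "(\<lambda>x. c * x ^ i) ` (K - {0}) \<subseteq> K - {0}"
  proof
    fix y assume "y \<in> (\<lambda>x. c * x ^ i) ` (K - {0})"
    then obtain x where "x \<in> K" "x \<noteq> 0" "y = c * x ^ i" by blast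
    then show "y \<in> K - {0}"
      using assms(2) is_GF_mult[OF assms(1), of c] is_GF_power[OF assms(1), of x i] by simp
  qed
  moreover have "finite (K - {0})"
    using is_GF_finite[OF assms(1)] by simp
  ultimately have "(\<lambda>x. c * x ^ i) ` (K - {0}) = K - {0}"
    by (intro endo_inj_surj)
  moreover have "- y \<in> K - {0}"
    using assms(3) is_GF_uminus[OF assms(1)] by auto
  ultimately have "- y \<in> (\<lambda>x. c * x ^ i) ` (K - {0})"
    by (simp only:)
  then obtain x where x: "x \<in> K - {0}" "- y = c * x ^ i"
    by blast
  then have "c * x ^ i + y = 0"
    by (simp flip: x(2))
  then show ?thesis
    using x(1) by blast
qed

text \<open>A term whose exponent is divisible by \<open>q - 1\<close> is constant on
  \<open>K - {0}\<close>. The other term then yields a nonzero root, whereas injectivity leaves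
  \<open>0\<close> as the only root.\<close>

lemma permutation_binomial_exponents:
  assumes "is_GF q K" "b \<in> K - {0}" "inj_on (poly (binom_poly b n m)) K"
    and "1 \<le> m" "m < n" "\<not> q - 1 dvd n - m"
  shows "0 < n mod (q - 1)" and "0 < m mod (q - 1)"
proof -
  let ?g = "\<lambda>x. b * x ^ n + x ^ m"
  have inj: "inj_on ?g K" using assms(3) by (simp cong: inj_on_cong)
  have nz: "?g x \<noteq> 0" if "x \<in> K - {0}" for x
    using inj_onD[OF inj, of x 0] that is_GF_0[OF assms(1)] assms(4,5)
    by (auto simp: power_0_left)
  have inj': "inj_on ?g (K - {0})"
    using inj by (rule inj_on_subset) auto
  have one: "1 \<in> K - {0}" using is_GF_1[OF assms(1)] by simp
  show "0 < n mod (q - 1)"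
  proof (rule ccontr)
    assume "\<not> 0 < n mod (q - 1)"
    then have eq: "?g x = 1 * x ^ m + b" if "x \<in> K - {0}" for x
      using is_GF_power_mod[OF assms(1) that, of n] by simp
    have "inj_on (\<lambda>x. 1 * x ^ m + b) (K - {0})"
      by (rule inj_on_cong[THEN iffD1, OF _ inj']) (erule eq)
    then show False
      using power_inj_imp_root[OF assms(1) one assms(2)] eq nz by metis
  qed
  show "0 < m mod (q - 1)"
  proof (rule ccontr)
    assume "\<not> 0 < m mod (q - 1)"
    then have eq: "?g x = b * x ^ n + 1" if "x \<in> K - {0}" for x
      using is_GF_power_mod[OF assms(1) that, of m] by simp
    have "inj_on (\<lambda>x. b * x ^ n + 1) (K - {0})"
      by (rule inj_on_cong[THEN iffD1, OF _ inj']) (erule eq)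
    then show False
      using power_inj_imp_root[OF assms(1,2) one] eq nz by metis
  qed
qed

text \<open>Both exponents reduce to their positive residues modulo \<open>q - 1\<close>, which
  differ because \<open>q - 1\<close> does not divide \<open>n - m\<close>.\<close>

lemma permutation_binomial_cong_binomial:
  assumes "is_GF q K" "b \<in> K - {0}" "inj_on (poly (binom_poly b n m)) K"
    and "1 \<le> m" "m < n" "\<not> q - 1 dvd n - m"
  shows "\<exists>m1 n1. 0 < m1 \<and> m1 < q - 1 \<and> 0 < n1 \<and> n1 < q - 1 \<and> m1 \<noteq> n1 \<and>
    cong_over K (binom_poly b n m) (binom_poly b n1 m1)
      (Polynomial.monom 1 q - Polynomial.monom 1 1)"
proof -
  note pos = permutation_binomial_exponents[OF assms]
  have q: "2 \<le> q" by (rule is_GF_ge_2[OF assms(1)])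
  have ne: "m mod (q - 1) \<noteq> n mod (q - 1)"
    using assms(5,6) by (simp add: mod_eq_dvd_iff_nat eq_commute[of "m mod _"])
  have "b \<in> K" using assms(2) by simp
  have "cong_over K (binom_poly b n m) (binom_poly b (n mod (q - 1)) (m mod (q - 1)))
      (Polynomial.monom 1 q - Polynomial.monom 1 1)"
    unfolding binom_poly_def
    by (intro cong_over_add[OF assms(1)] monom_cong_over_mod[OF assms(1)] pos q
        is_GF_1[OF assms(1)] \<open>b \<in> K\<close>)
  then show ?thesis
    using pos ne q by (intro exI[of _ "m mod (q - 1)"] exI[of _ "n mod (q - 1)"]) simp
qed

text \<open>Both exponents have the same residue \<open>k\<close>, so the map is
  \<open>(b + 1) * x ^ k\<close> on \<open>K - {0}\<close>; its injectivity forces \<open>k\<close>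
  to be coprime to \<open>q - 1\<close>.\<close>

lemma permutation_binomial_cong_monomial:
  assumes "is_GF q K" "b \<in> K - {0}" "inj_on (poly (binom_poly b n m)) K"
    and "1 \<le> m" "m < n" "q - 1 dvd n - m"
  shows "\<exists>k. 0 < k \<and> k < q - 1 \<and> gcd (q - 1) k = 1 \<and>
    cong_over K (binom_poly b n m) (Polynomial.monom (b + 1) k)
      (Polynomial.monom 1 q - Polynomial.monom 1 1)"
proof -
  have inj: "inj_on (\<lambda>x. b * x ^ n + x ^ m) K" using assms(3) by (simp cong: inj_on_cong)
  define k where "k = m mod (q - 1)"
  have k: "n mod (q - 1) = k"
    using assms(5,6) by (simp add: k_def mod_eq_dvd_iff_nat)
  have g: "b * x ^ n + x ^ m = (b + 1) * x ^ k" if "x \<in> K - {0}" for x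
    using is_GF_power_mod[OF assms(1) that, of n] is_GF_power_mod[OF assms(1) that, of m]
    by (simp only: k k_def[symmetric] distrib_right mult_1)
  have q: "2 \<le> q" by (rule is_GF_ge_2[OF assms(1)])
  \<comment> \<open>There are \<open>gcd (q - 1) k\<close> such roots of unity. The map takes the
    same value at each of them as at \<open>1\<close>, so injectivity leaves a single one.\<close>
  have "card {x :: 'a. x ^ gcd (q - 1) k = 1} = gcd (q - 1) k"
    by (rule is_GF_power_image(2)[OF assms(1), where d = "(q - 1) div gcd (q - 1) k"]) simp
  moreover have "{x :: 'a. x ^ gcd (q - 1) k = 1} = {1}"
  proof -
    have "x = 1" if "x ^ gcd (q - 1) k = 1" for x :: 'a
    proof -
      have x: "x ^ (q - 1) = 1" "x ^ k = 1"
        using that power_gcd_eq_1_iff[of "q - 1" x k] q by auto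
      then have "x \<in> K - {0}"
        using is_GF_nonzero_eq[OF assms(1)] by blast
      then show ?thesis
        using inj_onD[OF inj, of x 1] g[of x] g[of 1] x is_GF_1[OF assms(1)] by simp
    qed
    then show ?thesis by auto
  qed
  ultimately have gcd: "gcd (q - 1) k = 1" by simp
  \<comment> \<open>For \<open>q = 2\<close> coprimality would allow \<open>k = 0\<close>. This case
    is excluded because then \<open>b = 1\<close> and the map vanishes at both \<open>0\<close> and
    \<open>1\<close>.\<close>
  have "q \<noteq> 2"
  proof
    assume q2: "q = 2"
    then have "b = 1"
      using is_GF_power_card[OF assms(1,2)] by simp
    have "card {0, 1 :: 'a} = card K"
      using is_GF_card[OF assms(1)] q2 by simp
    then have "{0, 1 :: 'a} = K"
      using is_GF_0[OF assms(1)] is_GF_1[OF assms(1)] is_GF_finite[OF assms(1)]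
      by (intro card_subset_eq) auto
    moreover have "1 + 1 \<in> K"
      using is_GF_1[OF assms(1)] is_GF_add[OF assms(1)] by blast
    moreover have "1 + 1 \<noteq> (1 :: 'a)"
      by (metis add_cancel_right_right one_neq_zero)
    ultimately have "1 + 1 = (0 :: 'a)"
      by blast
    then show False
      using inj_onD[OF inj, of 1 0] \<open>b = 1\<close> is_GF_0[OF assms(1)] is_GF_1[OF assms(1)] assms(4,5)
      by (auto simp: power_0_left)
  qed
  \<comment> \<open>\<open>gcd (q - 1) 0\<close> is \<open>q - 1\<close>, which exceeds
    \<open>1\<close> once \<open>q > 2\<close>.\<close>
  then have pos: "0 < k"
    using gcd q by (auto intro!: Nat.gr0I)
  have "b \<in> K" using assms(2) by simp
  have "cong_over K (binom_poly b n m) (Polynomial.monom b k + Polynomial.monom 1 k)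
      (Polynomial.monom 1 q - Polynomial.monom 1 1)"
    unfolding binom_poly_def
    by (intro cong_over_add[OF assms(1)] pos q
        monom_cong_over_mod[OF assms(1) \<open>b \<in> K\<close>, of n q, unfolded k]
        monom_cong_over_mod[OF assms(1) is_GF_1[OF assms(1)], of m q, folded k_def])
  moreover have "k < q - 1"
    using q by (simp add: k_def)
  ultimately show ?thesis
    using pos gcd by (intro exI[of _ k]) (simp add: add_monom)
qed

section \<open>Binomials over subfields: existence, number and reduction\<close>

theorem theorem9:
  fixes p r s q n m d :: nat
    and a :: "'k::field" and f :: "'k poly" and Fq Fs :: "'k set"
  assumes "prime p" and "alg_closure_of_prime_field TYPE('k) p"
    and "0 < r" and "q = p ^ r" and "is_GF q Fq"
    and "1 \<le> m" and "m < n" and "n \<le> q - 1" and "gcd m n = 1"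
    and "a \<in> Fq - {0}" and "f = binom_poly a n m"
    and "bij_betw (poly f) Fq Fq"
    and "0 < s" and "s dvd r" and "is_GF (p ^ s) Fs"
    and "d = gcd (n - m) (q - 1)"
  shows
    "((\<exists>g. g \<in> equiv_binomials Fq n m f Fs) \<longleftrightarrow>
        mult_order Fq a dvd lcm (p ^ s - 1) ((q - 1) div d))
     \<and>
     ((\<exists>g. g \<in> equiv_binomials Fq n m f Fs) \<longrightarrow>
        card (equiv_binomials Fq n m f Fs) = gcd (p ^ s - 1) ((q - 1) div d) \<and>
        (\<forall>g \<in> equiv_binomials Fq n m f Fs. bij_betw (poly g) Fs Fs) \<and>
        inj_on (\<lambda>g. restrict (poly g) Fs) (equiv_binomials Fq n m f Fs) \<and>
        (\<forall>b. binom_poly b n m \<in> equiv_binomials Fq n m f Fs \<longrightarrow>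
           (\<not> (p ^ s - 1) dvd d \<longrightarrow>
              (\<exists>m1 n1. 0 < m1 \<and> m1 < p ^ s - 1 \<and> 0 < n1 \<and> n1 < p ^ s - 1 \<and> m1 \<noteq> n1 \<and>
                 cong_over Fs (binom_poly b n m) (binom_poly b n1 m1)
                   (Polynomial.monom 1 (p ^ s) - Polynomial.monom 1 1))) \<and>
           ((p ^ s - 1) dvd d \<longrightarrow>
              (\<exists>k. 0 < k \<and> k < p ^ s - 1 \<and> gcd (p ^ s - 1) k = 1 \<and>
                 cong_over Fs (binom_poly b n m) (Polynomial.monom (b + 1) k)
                   (Polynomial.monom 1 (p ^ s) - Polynomial.monom 1 1)))))
     \<and>
     (\<forall>t Ft. 0 < t \<longrightarrow> is_GF (p ^ t) Ft \<longrightarrow>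
        ((\<exists>g. g \<in> equiv_binomials Fq n m f (Ft \<inter> Fq)) \<longleftrightarrow>
           mult_order Fq a dvd lcm (p ^ t - 1) ((q - 1) div d)))"
proof -
  note p = \<open>prime p\<close> and GF = \<open>is_GF q Fq\<close> and GFs = \<open>is_GF (p ^ s) Fs\<close>
    and mn = \<open>m < n\<close> and a = \<open>a \<in> Fq - {0}\<close> and f = \<open>f = binom_poly a n m\<close>
    and d = \<open>d = gcd (n - m) (q - 1)\<close>
  let ?E = "equiv_binomials Fq n m f Fs"
  have dvd: "p ^ s - 1 dvd q - 1"
    unfolding \<open>q = p ^ r\<close>
    using \<open>s dvd r\<close> prime_gt_0_nat[OF p] by (rule pow_minus_1_dvd)
  then have sub: "Fs \<subseteq> Fq"
    by (rule is_GF_mono[OF GFs GF])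
  \<comment> \<open>The existence and counting lemmas speak of an intersection of fields, as
    arbitrary \<open>t\<close> requires; for \<open>s dvd r\<close> it is \<open>Fs\<close>
    itself.\<close>
  then have int: "Fs \<inter> Fq = Fs"
    by blast
  \<comment> \<open>As \<open>p ^ s - 1\<close> divides \<open>q - 1\<close>, only the argument
    \<open>n - m\<close> of the gcd matters.\<close>
  have dvd_d: "p ^ s - 1 dvd d \<longleftrightarrow> p ^ s - 1 dvd n - m"
    using dvd by (simp add: d)
  note ex_iff = ex_equiv_binomials_iff[OF GF _ mn a, folded f d]
  have inj: "inj_on (poly g) Fs" if "g \<in> ?E" for g
  proof -
    have "inj_on (poly g) Fq"
      using that \<open>bij_betw (poly f) Fq Fq\<close> unfolding equiv_binomials_def
      by (blast intro: equiv_binomial_permutes[OF GF mn])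
    then show ?thesis
      using sub by (rule inj_on_subset)
  qed
  have bij: "bij_betw (poly g) Fs Fs" if "g \<in> ?E" for g
  proof -
    have "poly g ` Fs \<subseteq> Fs"
      using that poly_in_is_GF[OF GFs] by (auto simp: equiv_binomials_def)
    then show ?thesis
      using inj[OF that] is_GF_finite[OF GFs] by (simp add: bij_betw_def endo_inj_surj)
  qed
  have distinct: "inj_on (\<lambda>g. restrict (poly g) Fs) ?E"
  proof (rule inj_onI)
    fix g h
    assume g: "g \<in> ?E" and h: "h \<in> ?E" and eq: "restrict (poly g) Fs = restrict (poly h) Fs"
    obtain b c where bc: "g = binom_poly b n m" "h = binom_poly c n m"
      using g h by (auto simp: equiv_binomials_def d_equivalent_def)
    \<comment> \<open>The value at \<open>1\<close> is the coefficient plus \<open>1\<close>, so it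
      already determines the binomial.\<close>
    have "poly g 1 = poly h 1"
      using fun_cong[OF eq, of 1] is_GF_1[OF GFs] by simp
    then show "g = h"
      by (simp add: bc)
  qed
  have coeff: "b \<in> Fs - {0}" if "binom_poly b n m \<in> ?E" for b
    using that binom_poly_in_polys_over_iff[OF is_GF_0[OF GFs] is_GF_1[OF GFs] mn]
    by (auto simp: equiv_binomials_def d_equivalent_def binom_poly_eq_iff[OF mn])
  have "(\<exists>g. g \<in> ?E) \<longleftrightarrow> mult_order Fq a dvd lcm (p ^ s - 1) ((q - 1) div d)"
    using ex_iff[OF GFs] by (simp only: int)
  moreover have "card ?E = gcd (p ^ s - 1) ((q - 1) div d)" if "\<exists>g. g \<in> ?E"
    using card_equiv_binomials[OF GF GFs mn a] that unfolding int f d by blast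
  moreover note bij distinct
  moreover have "\<exists>m1 n1. 0 < m1 \<and> m1 < p ^ s - 1 \<and> 0 < n1 \<and> n1 < p ^ s - 1 \<and> m1 \<noteq> n1 \<and>
      cong_over Fs (binom_poly b n m) (binom_poly b n1 m1)
        (Polynomial.monom 1 (p ^ s) - Polynomial.monom 1 1)"
    if "binom_poly b n m \<in> ?E" "\<not> p ^ s - 1 dvd d" for b
    using that(2) unfolding dvd_d
    by (intro permutation_binomial_cong_binomial[OF GFs coeff[OF that(1)] inj[OF that(1)]]
        \<open>1 \<le> m\<close> mn)
  moreover have "\<exists>k. 0 < k \<and> k < p ^ s - 1 \<and> gcd (p ^ s - 1) k = 1 \<and>
      cong_over Fs (binom_poly b n m) (Polynomial.monom (b + 1) k)
        (Polynomial.monom 1 (p ^ s) - Polynomial.monom 1 1)"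
    if "binom_poly b n m \<in> ?E" "p ^ s - 1 dvd d" for b
    using that(2) unfolding dvd_d
    by (intro permutation_binomial_cong_monomial[OF GFs coeff[OF that(1)] inj[OF that(1)]]
        \<open>1 \<le> m\<close> mn)
  moreover note ex_iff
  ultimately show ?thesis
    by (intro conjI impI allI ballI) blast+
qed

end
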